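(* Let $n>4$ and let $\mathbf{H}$ be the $n\times n$ heptadiagonal matrix built from the sequences $\{a_i\},\{b_i\},\{c_i\},\{d_i\},\{e_i\},\{f_i\},\{g_i\}$ as described in the context, where $g_i\neq 0$ for all $1\le i\le n$, $g_{n-2}=g_{n-1}=g_n=1$ and $f_{n-1}=f_n=e_n=0$. Let $X_i$ ($1\le i\le n+1$), $Y_i$ ($1\le i\le n+2$), $Z_i$ ($1\le i\le n+3$) be the determinants defined in the context. Suppose that $X_{n+1}\neq 0$. Then $\mathbf{H}$ is invertible, and the last three columns of $\mathbf{H}^{-1}$ are given as follows: the $n$-th column of $\mathbf{H}^{-1}$ is $$\left[\frac{-Z_1}{Z_{n+3}},\frac{-Z_2}{Z_{n+3}},\dots,\frac{-Z_n}{Z_{n+3}}\right]^t,$$ the $(n-1)$-th column of $\mathbf{H}^{-1}$ is $$\left[\frac{-Y_1}{Y_{n+2}},\frac{-Y_2}{Y_{n+2}},\dots,\frac{-Y_n}{Y_{n+2}}\right]^t,$$ and the $(n-2)$-th column of $\mathbf{H}^{-1}$ is $$\left[\frac{-X_1}{X_{n+1}},\frac{-X_2}{X_{n+1}},\dots,\frac{-X_n}{X_{n+1}}\right]^t.$$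
   Context: Let $n>4$ be an integer, and let $\{a_i\}_{4\le i\le n}$, $\{b_i\}_{3\le i\le n}$, $\{c_i\}_{2\le i\le n}$, $\{d_i\}_{1\le i\le n}$, $\{e_i\}_{1\le i\le n}$, $\{f_i\}_{1\le i\le n}$, $\{g_i\}_{1\le i\le n}$ be sequences of (real or complex) numbers with $g_i\ne 0$ for all $i$, $g_{n-2}=g_{n-1}=g_n=1$ and $f_{n-1}=f_n=e_n=0$. The heptadiagonal matrix $\mathbf{H}$ is the $n\times n$ matrix whose entries are, whenever both indices lie in $\{1,\dots,n\}$: $\mathbf{H}_{i,i-3}=a_i$, $\mathbf{H}_{i,i-2}=b_i$, $\mathbf{H}_{i,i-1}=c_i$, $\mathbf{H}_{i,i}=d_i$, $\mathbf{H}_{i,i+1}=e_i$, $\mathbf{H}_{i,i+2}=f_i$, $\mathbf{H}_{i,i+3}=g_i$, and all other entries are $0$. Define three sequences $\{A_i\}_{1\le i\le n+3}$, $\{B_i\}_{1\le i\le n+3}$, $\{C_i\}_{1\le i\le n+3}$ of numbers by the initial values $(A_1,A_2,A_3)=(0,0,1)$, $(B_1,B_2,B_3)=(0,1,0)$, $(C_1,C_2,C_3)=(1,0,0)$, and by requiring that each sequence $U\in\{A,B,C\}$ satisfies $$d_1U_1+e_1U_2+f_1U_3+g_1U_4=0,$$ $$c_2U_1+d_2U_2+e_2U_3+f_2U_4+g_2U_5=0,$$ $$b_3U_1+c_3U_2+d_3U_3+e_3U_4+f_3U_5+g_3U_6=0,$$ $$a_iU_{i-3}+b_iU_{i-2}+c_iU_{i-1}+d_iU_i+e_iU_{i+1}+f_iU_{i+2}+g_iU_{i+3}=0\quad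 (4\le i\le n).$$ Define $$X_i=\begin{vmatrix} A_i & A_{n+2} & A_{n+3} \\ B_i & B_{n+2} & B_{n+3} \\ C_i & C_{n+2} & C_{n+3} \end{vmatrix}\ (1\le i\le n+1),\qquad Y_i=\begin{vmatrix} A_i & A_{n+1} & A_{n+3} \\ B_i & B_{n+1} & B_{n+3} \\ C_i & C_{n+1} & C_{n+3} \end{vmatrix}\ (1\le i\le n+2),$$ $$Z_i=\begin{vmatrix} A_i & A_{n+1} & A_{n+2} \\ B_i & B_{n+1} & B_{n+2} \\ C_i & C_{n+1} & C_{n+2} \end{vmatrix}\ (1\le i\le n+3).$$ The superscript $t$ denotes transpose. *)

theory Defs
  imports "Jordan_Normal_Form.Determinant"
begin

(* The coefficient sequences are 1-based; matrix positions (i, j) are 0-based, so row i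
   uses the coefficients with index i + 1. *)
definition heptadiagonal ::
  "nat \<Rightarrow> (nat \<Rightarrow> 'a) \<Rightarrow> (nat \<Rightarrow> 'a) \<Rightarrow> (nat \<Rightarrow> 'a) \<Rightarrow> (nat \<Rightarrow> 'a) \<Rightarrow>
    (nat \<Rightarrow> 'a) \<Rightarrow> (nat \<Rightarrow> 'a) \<Rightarrow> (nat \<Rightarrow> 'a) \<Rightarrow> 'a :: field mat" where
  "heptadiagonal n a b c d e f g = mat n n (\<lambda>(i, j).
     if i = j + 3 then a (i + 1)
     else if i = j + 2 then b (i + 1)
     else if i = j + 1 then c (i + 1)
     else if i = j then d (i + 1)
     else if j = i + 1 then e (i + 1)
     else if j = i + 2 then f (i + 1)
     else if j = i + 3 then g (i + 1)
     else 0)"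

(* When g i is nonzero for 1 \<le> i \<le> n, these equations determine U 4, ..., U (n + 3)
   uniquely from U 1, U 2, U 3; values of U outside {1..n+3} are unconstrained. *)
definition heptadiagonal_recurrence ::
  "nat \<Rightarrow> (nat \<Rightarrow> 'a) \<Rightarrow> (nat \<Rightarrow> 'a) \<Rightarrow> (nat \<Rightarrow> 'a) \<Rightarrow> (nat \<Rightarrow> 'a) \<Rightarrow>
    (nat \<Rightarrow> 'a) \<Rightarrow> (nat \<Rightarrow> 'a) \<Rightarrow> (nat \<Rightarrow> 'a) \<Rightarrow> (nat \<Rightarrow> 'a :: field) \<Rightarrow> bool" where
  "heptadiagonal_recurrence n a b c d e f g U \<longleftrightarrow>
     d 1 * U 1 + e 1 * U 2 + f 1 * U 3 + g 1 * U 4 = 0 \<and>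
     c 2 * U 1 + d 2 * U 2 + e 2 * U 3 + f 2 * U 4 + g 2 * U 5 = 0 \<and>
     b 3 * U 1 + c 3 * U 2 + d 3 * U 3 + e 3 * U 4 + f 3 * U 5 + g 3 * U 6 = 0 \<and>
     (\<forall>i\<in>{4..n}. a i * U (i - 3) + b i * U (i - 2) + c i * U (i - 1) + d i * U i
        + e i * U (i + 1) + f i * U (i + 2) + g i * U (i + 3) = 0)"

definition det3 ::
  "(nat \<Rightarrow> 'a) \<Rightarrow> (nat \<Rightarrow> 'a) \<Rightarrow> (nat \<Rightarrow> 'a) \<Rightarrow> nat \<Rightarrow> nat \<Rightarrow> nat \<Rightarrow> 'a :: field" where
  "det3 A B C p q r = det (mat_of_rows_list 3
     [[A p, A q, A r],
      [B p, B q, B r],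
      [C p, C q, C r]])"

end

(* A solution U of the recurrence, cut down to its first n entries, is mapped by H to the vector
   that is zero except for the last three entries -U(n+1), -U(n+2), -U(n+3).  The sequences X, Y, Z
   are the linear combinations of A, B, C for which two of these three values vanish, so they are
   mapped to multiples of unit vectors.  Conversely, since g does not vanish, a kernel vector of H
   extends to a solution of the recurrence with these three values zero; the nonvanishing
   determinant X(n+1) forces it to be zero. *)

theory Submission
  imports Defs
begin

section \<open>Explicit determinants of sizes two and three\<close>

lemma det_mat_2_2: "det (mat 2 2 h) = h (0, 0) * h (1, 1) - h (1, 0) * (h (0, 1) :: 'a :: field)"
proof -
  have "det (mat 2 2 h) = (\<Sum>i<2. mat 2 2 h $$ (i, 0) * cofactor (mat 2 2 h) i 0)"
    by (rule laplace_expansion_column) simp_all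
  then show ?thesis
    by (simp add: cofactor_def mat_delete_def numeral_2_eq_2 det_single)
qed

lemma det3_expand:
  "det3 A B C p q r =
     A p * (B q * C r - B r * C q) - B p * (A q * C r - A r * C q) + C p * (A q * B r - A r * B q)"
proof -
  let ?M = "mat_of_rows_list 3 [[A p, A q, A r], [B p, B q, B r], [C p, C q, C r]]"
  have M: "?M \<in> carrier_mat 3 3"
    by (simp add: mat_of_rows_list_def numeral_3_eq_3)
  have "det ?M = (\<Sum>i<3. ?M $$ (i, 0) * cofactor ?M i 0)"
    by (rule laplace_expansion_column[OF M]) simp
  then show ?thesis
    by (simp add: det3_def cofactor_def mat_delete_def mat_of_rows_list_def
        det_mat_2_2[unfolded numeral_2_eq_2] numeral_3_eq_3 algebra_simps)
qed

text \<open>Two equal columns. This is what makes each of \<open>X\<close>, \<open>Y\<close>,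
  \<open>Z\<close> vanish at two of the indices \<open>n + 1\<close>, \<open>n + 2\<close>,
  \<open>n + 3\<close>.\<close>

lemma det3_repeated: "det3 A B C q q r = 0" "det3 A B C r q r = 0"
  by (simp_all add: det3_expand algebra_simps)

section \<open>Action of the matrix on vectors, compared with the recurrence\<close>

lemma heptadiagonal_carrier [simp]:
  "heptadiagonal n a b c d e f g \<in> carrier_mat n n"
  by (simp add: heptadiagonal_def)

lemma heptadiagonal_mult_vec_index:
  assumes "i < n" "v \<in> carrier_vec n"
  shows "(heptadiagonal n a b c d e f g *\<^sub>v v) $ i =
      (if 3 \<le> i then a (i + 1) * v $ (i - 3) else 0)
    + (if 2 \<le> i then b (i + 1) * v $ (i - 2) else 0)
    + (if 1 \<le> i then c (i + 1) * v $ (i - 1) else 0)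
    + d (i + 1) * v $ i
    + (if i + 1 < n then e (i + 1) * v $ (i + 1) else 0)
    + (if i + 2 < n then f (i + 1) * v $ (i + 2) else 0)
    + (if i + 3 < n then g (i + 1) * v $ (i + 3) else 0)"
proof -
  have delta: "(\<Sum>j\<in>{0..<n}. if j = k then h j else 0) = (if k < n then h k else 0)"
    for k and h :: "nat \<Rightarrow> 'a"
    by simp
  \<comment> \<open>Subdiagonals satisfy \<open>i = j + k\<close>; solving for \<open>j\<close>
    needs \<open>k \<le> i\<close>, since subtraction on the naturals truncates.\<close>
  have below: "(\<Sum>j\<in>{0..<n}. if i = j + k then h j else 0) = (if k \<le> i then h (i - k) else 0)"
    for k and h :: "nat \<Rightarrow> 'a"
  proof (cases "k \<le> i")
    case True
    then have "i = j + k \<longleftrightarrow> j = i - k" for j by auto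
    with True assms(1) show ?thesis by (simp add: delta)
  next
    case False
    then show ?thesis by (auto intro!: sum.neutral)
  qed
  have "(heptadiagonal n a b c d e f g *\<^sub>v v) $ i = (\<Sum>j\<in>{0..<n}.
      (if i = j + 3 then a (i + 1) * v $ j else 0)
    + (if i = j + 2 then b (i + 1) * v $ j else 0)
    + (if i = j + 1 then c (i + 1) * v $ j else 0)
    + (if j = i then d (i + 1) * v $ j else 0)
    + (if j = i + 1 then e (i + 1) * v $ j else 0)
    + (if j = i + 2 then f (i + 1) * v $ j else 0)
    + (if j = i + 3 then g (i + 1) * v $ j else 0))"
    using assms by (auto simp: heptadiagonal_def scalar_prod_def intro!: sum.cong)
  then show ?thesis
    using assms(1) by (simp only: sum.distrib delta below if_True)
qed

text \<open>Merges the four cases of the recurrence into one 0-based equation, with the same guards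
  as the matrix product, so that the two can be compared term by term.\<close>

lemma heptadiagonal_recurrence_index:
  assumes "heptadiagonal_recurrence n a b c d e f g U" "i < n"
  shows "(if 3 \<le> i then a (i + 1) * U (i - 2) else 0)
    + (if 2 \<le> i then b (i + 1) * U (i - 1) else 0)
    + (if 1 \<le> i then c (i + 1) * U i else 0)
    + d (i + 1) * U (i + 1) + e (i + 1) * U (i + 2) + f (i + 1) * U (i + 3) + g (i + 1) * U (i + 4)
    = 0"
proof -
  consider "i = 0" | "i = 1" | "i = 2" | "3 \<le> i" by linarith
  then show ?thesis
  proof cases
    case 4
    then have "i + 1 \<in> {4..n}" using assms(2) by auto
    with assms(1) have "a (i + 1) * U (i + 1 - 3) + b (i + 1) * U (i + 1 - 2)
        + c (i + 1) * U (i + 1 - 1) + d (i + 1) * U (i + 1) + e (i + 1) * U (i + 1 + 1)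
        + f (i + 1) * U (i + 1 + 2) + g (i + 1) * U (i + 1 + 3) = 0"
      unfolding heptadiagonal_recurrence_def by blast
    moreover have "i + 1 - 3 = i - 2" "i + 1 - 2 = i - 1" "i + 1 - 1 = i"
      "i + 1 + 1 = i + 2" "i + 1 + 2 = i + 3" "i + 1 + 3 = i + 4"
      using 4 by auto
    ultimately show ?thesis using 4 by (simp only:) simp
  qed (use assms(1) in \<open>simp_all add: heptadiagonal_recurrence_def numeral_eq_Suc\<close>)
qed

text \<open>Serves twice: to extend a kernel vector to a solution, and for \<open>det3\<close> as a
  function of its first column.\<close>

lemma heptadiagonal_recurrence_linear_combination:
  assumes "heptadiagonal_recurrence n a b c d e f g A"
    and "heptadiagonal_recurrence n a b c d e f g B"
    and "heptadiagonal_recurrence n a b c d e f g C"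
  shows "heptadiagonal_recurrence n a b c d e f g (\<lambda>i. x * A i + y * B i + z * C i)"
proof -
  have comb: "s = 0" if "p = 0" "q = 0" "r = 0" "s = x * p + y * q + z * r" for p q r s
    using that by simp
  note rec = assms[unfolded heptadiagonal_recurrence_def]
  show ?thesis
    unfolding heptadiagonal_recurrence_def
  proof (intro conjI ballI, goal_cases)
    case 1
    show ?case
      by (rule comb[OF rec[THEN conjunct1]]) (simp add: algebra_simps)
  next
    case 2
    show ?case
      by (rule comb[OF rec[THEN conjunct2, THEN conjunct1]]) (simp add: algebra_simps)
  next
    case 3
    show ?case
      by (rule comb[OF rec[THEN conjunct2, THEN conjunct2, THEN conjunct1]])
        (simp add: algebra_simps)
  next
    case (4 i)
    note last = rec[THEN conjunct2, THEN conjunct2, THEN conjunct2, THEN bspec, OF 4]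
    show ?case
      by (rule comb[OF last]) (simp add: algebra_simps)
  qed
qed

(* The hypotheses on e, f, g at the end of the index range remove the terms in which the
   recurrence reaches beyond index n, except for the last one. *)
lemma heptadiagonal_mult_recurrence:
  assumes "heptadiagonal_recurrence n a b c d e f g U" "n \<ge> 3"
    and "g (n - 2) = 1" "g (n - 1) = 1" "g n = 1"
    and "f (n - 1) = 0" "f n = 0" "e n = 0"
  shows "heptadiagonal n a b c d e f g *\<^sub>v vec n (\<lambda>j. U (j + 1)) =
    vec n (\<lambda>i. if i + 3 < n then 0 else - U (i + 4))"
proof (rule eq_vecI)
  fix i assume "i < dim_vec (vec n (\<lambda>i. if i + 3 < n then 0 else - U (i + 4)))"
  then have i: "i < n" by simp
  have shift: "3 \<le> i \<Longrightarrow> Suc (i - 3) = i - 2" "2 \<le> i \<Longrightarrow> Suc (i - 2) = i - 1"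
    "Suc 0 \<le> i \<Longrightarrow> Suc (i - Suc 0) = i" "Suc (Suc (Suc i)) = i + 3" "Suc (i + 3) = i + 4"
    by auto
  have last: "e (i + 1) = 0" if "\<not> i + 1 < n"
  proof -
    from that i have "i + 1 = n" by simp
    with assms show ?thesis by simp
  qed
  have last2: "f (i + 1) = 0" if "\<not> i + 2 < n"
  proof -
    from that i have "i + 1 = n \<or> i + 1 = n - 1" by auto
    with assms show ?thesis by metis
  qed
  have last3: "g (i + 1) = 1" if "\<not> i + 3 < n"
  proof -
    from that i have "i + 1 = n \<or> i + 1 = n - 1 \<or> i + 1 = n - 2" by auto
    with assms show ?thesis by metis
  qed
  have "(heptadiagonal n a b c d e f g *\<^sub>v vec n (\<lambda>j. U (j + 1))) $ i =
      (if 3 \<le> i then a (i + 1) * U (i - 2) else 0)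
    + (if 2 \<le> i then b (i + 1) * U (i - 1) else 0)
    + (if 1 \<le> i then c (i + 1) * U i else 0)
    + d (i + 1) * U (i + 1) + e (i + 1) * U (i + 2) + f (i + 1) * U (i + 3)
    + (if i + 3 < n then g (i + 1) * U (i + 4) else 0)"
    unfolding heptadiagonal_mult_vec_index[OF i vec_carrier]
    by (intro arg_cong2[where f = "(+)"])
      (use i last last2 in \<open>auto simp: shift\<close>)
  \<comment> \<open>For \<open>i + 3 < n\<close> this is the recurrence itself. In the last three
    rows the term \<open>g (i + 1) * U (i + 4)\<close> is missing and its coefficient is 1, so
    \<open>- U (i + 4)\<close> remains.\<close>
  also have "\<dots> = (if i + 3 < n then 0 else - U (i + 4))"
    using heptadiagonal_recurrence_index[OF assms(1) i] last3
    by (cases "i + 3 < n")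
      (simp_all only: if_True if_False mult_1 eq_neg_iff_add_eq_0 add_0_right simp_thms)
  finally show "(heptadiagonal n a b c d e f g *\<^sub>v vec n (\<lambda>j. U (j + 1))) $ i =
      vec n (\<lambda>i. if i + 3 < n then 0 else - U (i + 4)) $ i"
    using i by simp
qed (simp add: heptadiagonal_def)

section \<open>Forward substitution, and columns of an inverse\<close>

text \<open>Row \<open>i\<close> can be solved for entry \<open>i + 3\<close>, whose coefficient
  \<open>g (i + 1)\<close> is nonzero; hence the first three entries determine all others.\<close>

lemma heptadiagonal_forward_substitution:
  assumes v: "v \<in> carrier_vec n"
    and g: "\<And>i. i \<in> {1..n} \<Longrightarrow> g i \<noteq> 0"
    and zero: "\<And>i. i + 3 < n \<Longrightarrow> (heptadiagonal n a b c d e f g *\<^sub>v v) $ i = 0"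
    and init: "\<And>i. i < 3 \<Longrightarrow> i < n \<Longrightarrow> v $ i = 0"
  shows "v = 0\<^sub>v n"
proof -
  have "i < n \<Longrightarrow> v $ i = 0" for i
  proof (induction i rule: less_induct)
    case (less i)
    show ?case
    proof (cases "i < 3")
      case True
      with init less.prems show ?thesis by blast
    next
      case False
      then obtain k where k: "i = k + 3" by (metis add.commute le_Suc_ex not_less)
      have kn: "k < n" "k + 3 < n" using less.prems k by auto
      have prev: "v $ j = 0" if "j < k + 3" for j
        using less.IH[of j] less.prems that k by simp
      \<comment> \<open>Truncated differences are harmless: every index here is below
        \<open>k + 3\<close>.\<close>
      have "v $ (k - 3) = 0" "v $ (k - 2) = 0" "v $ (k - 1) = 0"
        "v $ k = 0" "v $ (k + 1) = 0" "v $ (k + 2) = 0"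
        by (intro prev; simp)+
      with zero[OF kn(2)] have "g (k + 1) * v $ (k + 3) = 0"
        unfolding heptadiagonal_mult_vec_index[OF kn(1) v] using kn
        by (simp only: mult_zero_right if_cancel add_0 if_True)
      with g[of "k + 1"] kn k show ?thesis by simp
    qed
  qed
  with v show ?thesis by (intro eq_vecI) auto
qed

text \<open>Applying \<open>G\<close> to \<open>Hx\<close> gives \<open>x\<close> on one side and
  \<open>t\<close> times column \<open>k\<close> of \<open>G\<close> on the other.\<close>

lemma inverse_col_eqI:
  fixes H G :: "'a :: field mat"
  assumes H: "H \<in> carrier_mat n n" and HG: "inverts_mat H G" and GH: "inverts_mat G H"
    and x: "x \<in> carrier_vec n" and k: "k < n"
    and Hx: "H *\<^sub>v x = t \<cdot>\<^sub>v unit_vec n k" and t: "t \<noteq> 0"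
  shows "col G k = vec n (\<lambda>i. x $ i / t)"
proof -
  have HG1: "H * G = 1\<^sub>m n" and GH1: "G * H = 1\<^sub>m (dim_row G)"
    using HG GH H by (auto simp: inverts_mat_def)
  \<comment> \<open>\<open>inverts_mat\<close> does not fix the size of \<open>G\<close>; comparing
    column counts in both products does.\<close>
  have G: "G \<in> carrier_mat n n"
    using H arg_cong[OF HG1, of dim_col] arg_cong[OF GH1, of dim_col] by auto
  have "x = (G * H) *\<^sub>v x" using GH1 G x by simp
  also have "\<dots> = G *\<^sub>v (H *\<^sub>v x)" using G H x by simp
  also have "\<dots> = t \<cdot>\<^sub>v col G k"
    unfolding Hx using G k by (auto simp: mult_mat_vec intro!: eq_vecI)
  finally have "x $ i = t * col G k $ i" if "i < n" for i
    using G that by (metis carrier_matD(1) dim_col index_smult_vec(1))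
  with t G show ?thesis by (intro eq_vecI) simp_all
qed

section \<open>Invertibility and the last three columns\<close>

theorem theorem2p1:
  fixes n :: nat
    and a b c d e f g A B C X Y Z :: "nat \<Rightarrow> 'a :: field"
    and H :: "'a mat"
  assumes "n > 4"
    and "\<And>i. i \<in> {1..n} \<Longrightarrow> g i \<noteq> 0"
    and "g (n - 2) = 1" and "g (n - 1) = 1" and "g n = 1"
    and "f (n - 1) = 0" and "f n = 0" and "e n = 0"
    and "H = heptadiagonal n a b c d e f g"
    and "A 1 = 0" and "A 2 = 0" and "A 3 = 1" and "heptadiagonal_recurrence n a b c d e f g A"
    and "B 1 = 0" and "B 2 = 1" and "B 3 = 0" and "heptadiagonal_recurrence n a b c d e f g B"
    and "C 1 = 1" and "C 2 = 0" and "C 3 = 0" and "heptadiagonal_recurrence n a b c d e f g C"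
    and "\<And>i. i \<in> {1..n + 1} \<Longrightarrow> X i = det3 A B C i (n + 2) (n + 3)"
    and "\<And>i. i \<in> {1..n + 2} \<Longrightarrow> Y i = det3 A B C i (n + 1) (n + 3)"
    and "\<And>i. i \<in> {1..n + 3} \<Longrightarrow> Z i = det3 A B C i (n + 1) (n + 2)"
    and "X (n + 1) \<noteq> 0"
  shows "invertible_mat H \<and>
    (\<forall>G. inverts_mat H G \<and> inverts_mat G H \<longrightarrow>
       col G (n - 1) = vec n (\<lambda>i. - Z (i + 1) / Z (n + 3)) \<and>
       col G (n - 2) = vec n (\<lambda>i. - Y (i + 1) / Y (n + 2)) \<and>
       col G (n - 3) = vec n (\<lambda>i. - X (i + 1) / X (n + 1)))"
proof -
  note n = assms(1) and g_nz = assms(2) and ends = assms(3-8) and H_def = assms(9)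
    and A = assms(10-13) and B = assms(14-17) and C = assms(18-21)
    and X = assms(22) and Y = assms(23) and Z = assms(24) and X_nz = assms(25)
  have n3: "n \<ge> 3" using n by simp
  have H: "H \<in> carrier_mat n n" by (simp add: H_def)
  note rec = heptadiagonal_recurrence_linear_combination[OF A(4) B(4) C(4)]
  have H_mult: "H *\<^sub>v vec n (\<lambda>j. U (j + 1)) = vec n (\<lambda>i. if i + 3 < n then 0 else - U (i + 4))"
    if "heptadiagonal_recurrence n a b c d e f g U" for U
    unfolding H_def by (rule heptadiagonal_mult_recurrence[OF that n3 ends])
  \<comment> \<open>The three denominators are one determinant up to the order of its columns: a
    transposition for \<open>Y\<close>, a cyclic shift for \<open>Z\<close>.\<close>
  define D where "D = det3 A B C (n + 1) (n + 2) (n + 3)"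
  have D: "X (n + 1) = D" "Y (n + 2) = - D" "Z (n + 3) = D"
    by (simp_all add: X Y Z D_def det3_expand algebra_simps)
  have D_nz: "D \<noteq> 0" using X_nz D by simp

  have "det H \<noteq> 0"
  proof
    assume "det H = 0"
    then obtain v where v: "v \<in> carrier_vec n" "v \<noteq> 0\<^sub>v n" "H *\<^sub>v v = 0\<^sub>v n"
      using det_0_iff_vec_prod_zero_field[OF H] by blast
    \<comment> \<open>The initial values of \<open>A\<close>, \<open>B\<close>, \<open>C\<close>
      make \<open>U 1\<close>, \<open>U 2\<close>, \<open>U 3\<close> equal to the first three
      entries of \<open>v\<close>.\<close>
    define U where "U = (\<lambda>i. v $ 2 * A i + v $ 1 * B i + v $ 0 * C i)"
    define u where "u = vec n (\<lambda>j. U (j + 1))"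
    have u: "u \<in> carrier_vec n" by (simp add: u_def)
    have Hu: "H *\<^sub>v u = vec n (\<lambda>i. if i + 3 < n then 0 else - U (i + 4))"
      unfolding u_def by (rule H_mult) (simp add: U_def rec)
    have "u - v = 0\<^sub>v n"
    proof (rule heptadiagonal_forward_substitution)
      show "(heptadiagonal n a b c d e f g *\<^sub>v (u - v)) $ i = 0" if "i + 3 < n" for i
        using that by (simp add: H_def[symmetric] mult_minus_distrib_mat_vec[OF H u v(1)] Hu v(3))
      show "(u - v) $ i = 0" if i: "i < 3" "i < n" for i
      proof -
        consider "i = 0" | "i = 1" | "i = 2" using i(1) by linarith
        then show ?thesis
          using i(2) A(1-3) B(1-3) C(1-3) v(1)
          by cases (simp_all add: u_def U_def numeral_eq_Suc)
      qed
    qed (use u v g_nz in simp_all)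
    then have "(u - v) $ i = 0" if "i < n" for i
      using that by simp
    then have uv: "u = v"
      using u v(1) by (intro eq_vecI) auto
    have "U (i + 4) = 0" if "i < n" "\<not> i + 3 < n" for i
    proof -
      have "(H *\<^sub>v u) $ i = 0" using that v(3) uv by simp
      then show ?thesis using that by (simp add: Hu)
    qed
    from this[of "n - 3"] this[of "n - 2"] this[of "n - 1"]
    have U0: "U (n + 1) = 0" "U (n + 2) = 0" "U (n + 3) = 0"
      using n by (simp_all add: numeral_eq_Suc Suc_diff_Suc)
    \<comment> \<open>Cramer's rule: replacing one row of \<open>D\<close> by the combination
      \<open>U\<close> multiplies \<open>D\<close> by the coefficient of that row. The new row is
      zero by \<open>U0\<close>.\<close>
    have "v $ 2 * D = det3 U B C (n + 1) (n + 2) (n + 3)"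
      "v $ 1 * D = det3 A U C (n + 1) (n + 2) (n + 3)"
      "v $ 0 * D = det3 A B U (n + 1) (n + 2) (n + 3)"
      unfolding D_def U_def det3_expand by (simp_all add: algebra_simps)
    then have "v $ 2 = 0" "v $ 1 = 0" "v $ 0 = 0"
      using D_nz U0 by (simp_all only: det3_expand) simp_all
    then have "u = 0\<^sub>v n" by (auto simp: u_def U_def)
    with uv v(2) show False by simp
  qed
  then have inv: "invertible_mat H"
    using det_non_zero_imp_unit[OF H] H
    by (auto simp: Units_def ring_mat_def invertible_mat_def inverts_mat_def)

  \<comment> \<open>Expansion along the first column; the coefficients are the cofactors formed from
    columns \<open>q\<close> and \<open>r\<close>.\<close>
  have comb: "heptadiagonal_recurrence n a b c d e f g (\<lambda>i. det3 A B C i q r)" for q r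
    using rec[of "B q * C r - B r * C q" "- (A q * C r - A r * C q)" "A q * B r - A r * B q"]
    by (simp add: det3_expand algebra_simps)
  have cols: "col G (n - 1) = vec n (\<lambda>i. - Z (i + 1) / Z (n + 3)) \<and>
       col G (n - 2) = vec n (\<lambda>i. - Y (i + 1) / Y (n + 2)) \<and>
       col G (n - 3) = vec n (\<lambda>i. - X (i + 1) / X (n + 1))"
    if G: "inverts_mat H G" "inverts_mat G H" for G
  proof -
    \<comment> \<open>Treats the three columns at once: \<open>k\<close> is the 0-based column, and
      row \<open>k\<close> of the product is \<open>- W (k + 4)\<close>, the only one of the last
      three values that survives.\<close>
    have col: "col G k = vec n (\<lambda>i. - W (i + 1) / W (k + 4))"
      if W: "\<And>i. i \<in> {1..k + 4} \<Longrightarrow> W i = det3 A B C i q r" and k: "k < n" "n \<le> k + 3"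
        and nz: "W (k + 4) \<noteq> 0"
        and other: "\<And>i. i < n \<Longrightarrow> n \<le> i + 3 \<Longrightarrow> i \<noteq> k \<Longrightarrow> det3 A B C (i + 4) q r = 0"
      for k q r and W :: "nat \<Rightarrow> 'a"
    proof -
      have "H *\<^sub>v vec n (\<lambda>j. det3 A B C (j + 1) q r) = - W (k + 4) \<cdot>\<^sub>v unit_vec n k"
        unfolding H_mult[OF comb] using k W[of "k + 4"] other
        by (intro eq_vecI) (auto simp: unit_vec_def)
      from inverse_col_eqI[OF H G _ k(1) this] nz
      have "col G k = vec n (\<lambda>i. det3 A B C (i + 1) q r / - W (k + 4))"
        by (auto intro!: eq_vecI)
      also have "\<dots> = vec n (\<lambda>i. - W (i + 1) / W (k + 4))"
        using k W by (intro eq_vecI) auto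
      finally show ?thesis .
    qed
    have shift: "n - 1 + 4 = n + 3" "n - 2 + 4 = n + 2" "n - 3 + 4 = n + 1" using n by auto
    have split: "i = n - 1 \<or> i = n - 2 \<or> i = n - 3" if "i < n" "n \<le> i + 3" for i
      using that by auto
    have "col G (n - 1) = vec n (\<lambda>i. - Z (i + 1) / Z (n - 1 + 4))"
    proof (rule col)
      \<comment> \<open>In the other two of the last three rows, \<open>i + 4\<close> is one of the
        fixed columns \<open>n + 1\<close>, \<open>n + 2\<close>.\<close>
      show "det3 A B C (i + 4) (n + 1) (n + 2) = 0" if "i < n" "n \<le> i + 3" "i \<noteq> n - 1" for i
        using split[OF that(1,2)] that(3)
        by (elim disjE) (simp_all only: shift det3_repeated simp_thms)
      show "Z i = det3 A B C i (n + 1) (n + 2)" if "i \<in> {1..n - 1 + 4}" for i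
        using that Z[of i] by (simp only: shift)
      show "Z (n - 1 + 4) \<noteq> 0"
        using D D_nz by (simp only: shift neg_equal_0_iff_equal simp_thms)
    qed (use n in auto)
    moreover have "col G (n - 2) = vec n (\<lambda>i. - Y (i + 1) / Y (n - 2 + 4))"
    proof (rule col)
      show "det3 A B C (i + 4) (n + 1) (n + 3) = 0" if "i < n" "n \<le> i + 3" "i \<noteq> n - 2" for i
        using split[OF that(1,2)] that(3)
        by (elim disjE) (simp_all only: shift det3_repeated simp_thms)
      show "Y i = det3 A B C i (n + 1) (n + 3)" if "i \<in> {1..n - 2 + 4}" for i
        using that Y[of i] by (simp only: shift)
      show "Y (n - 2 + 4) \<noteq> 0"
        using D D_nz by (simp only: shift neg_equal_0_iff_equal simp_thms)
    qed (use n in auto)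
    moreover have "col G (n - 3) = vec n (\<lambda>i. - X (i + 1) / X (n - 3 + 4))"
    proof (rule col)
      show "det3 A B C (i + 4) (n + 2) (n + 3) = 0" if "i < n" "n \<le> i + 3" "i \<noteq> n - 3" for i
        using split[OF that(1,2)] that(3)
        by (elim disjE) (simp_all only: shift det3_repeated simp_thms)
      show "X i = det3 A B C i (n + 2) (n + 3)" if "i \<in> {1..n - 3 + 4}" for i
        using that X[of i] by (simp only: shift)
      show "X (n - 3 + 4) \<noteq> 0"
        using D D_nz by (simp only: shift neg_equal_0_iff_equal simp_thms)
    qed (use n in auto)
    ultimately show ?thesis by (simp only: shift)
  qed
  from inv cols show ?thesis by blast
qed

end
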